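(* Let $Z=(Z_1,\dots,Z_n)$ be an isotropic log-concave random vector in $\mathbb R^n$. Then for $n\ge 2$ and $0<\epsilon\le 1$, $$\mathbb P\Big(\max_{i=1,\dots,n}|Z_i|\ge t\ln n\Big)\le \frac{(8-2\epsilon)\,\epsilon^{-1}}{n^{\frac{(2-\epsilon)t}{2\sqrt3}-1}}\qquad\text{for all } t\ge \frac{2\sqrt3}{2-\epsilon}.$$
   Context: A random vector in $\mathbb R^n$ is log-concave if its law has the form $e^{-V(x)}dx$ with $V:\mathbb R^n\to\mathbb R\cup\{+\infty\}$ convex. It is isotropic if it is centered and its covariance matrix is the identity. *)

theory Defs
  imports "HOL-Probability.Probability"
begin

(* Excluding the value -\<infinity> keeps the right-hand side free of \<infinity> - \<infinity>;
   in ereal, 0 * \<infinity> = 0, so the endpoints u = 0 and v = 0 are harmless. *)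
definition convex_ereal :: "('a::real_vector \<Rightarrow> ereal) \<Rightarrow> bool" where
  "convex_ereal V \<longleftrightarrow>
     (\<forall>x. V x \<noteq> -\<infinity>) \<and>
     (\<forall>x y. \<forall>u\<ge>0. \<forall>v\<ge>0. u + v = 1 \<longrightarrow>
        V (u *\<^sub>R x + v *\<^sub>R y) \<le> ereal u * V x + ereal v * V y)"

fun exp_minus :: "ereal \<Rightarrow> ennreal" where
  "exp_minus (ereal r) = ennreal (exp (- r))"
| "exp_minus PInfty = 0"
| "exp_minus MInfty = \<infinity>"

(* distributed asks for a Borel measurable density.  This excludes no law: a convex V differs
   from its lower semicontinuous closure, which is convex and Borel, at most on the boundary of
   the convex set {x. V x < \<infinity>}, a Lebesgue null set. *)
definition log_concave :: "'a measure \<Rightarrow> ('a \<Rightarrow> real ^ 'n) \<Rightarrow> bool" where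
  "log_concave M Z \<longleftrightarrow>
     (\<exists>V. convex_ereal V \<and> distributed M lborel Z (\<lambda>x. exp_minus (V x)))"

definition covariance_matrix :: "'a measure \<Rightarrow> ('a \<Rightarrow> real ^ 'n) \<Rightarrow> real ^ 'n ^ 'n" where
  "covariance_matrix M Z =
     (\<chi> i j. \<integral>\<omega>. (Z \<omega> $ i - (\<integral>\<omega>'. Z \<omega>' $ i \<partial>M)) * (Z \<omega> $ j - (\<integral>\<omega>'. Z \<omega>' $ j \<partial>M)) \<partial>M)"

(* The integral of a non-integrable function is 0 by convention, so the existence of the first and
   second moments is stated explicitly. *)
definition isotropic :: "'a measure \<Rightarrow> ('a \<Rightarrow> real ^ 'n) \<Rightarrow> bool" where
  "isotropic M Z \<longleftrightarrow>
     integrable M Z \<and> integrable M (\<lambda>\<omega>. (norm (Z \<omega>))\<^sup>2) \<and>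
     (\<integral>\<omega>. Z \<omega> \<partial>M) = 0 \<and> covariance_matrix M Z = mat 1"

end

theory Submission
  imports Defs
begin

text \<open>
  By the union bound it suffices to control a single coordinate \<open>X\<close> of the vector, which has mean 0 and
  variance 1.  The proof shows that \<open>P (X \<ge> s) \<le> exp ((1 - s) / sqrt 3)\<close> for every \<open>s\<close>
  (\<open>log_concave_tail_bound\<close>); applied to \<open>X\<close> and \<open>- X\<close>, this gives the theorem with room to spare
  in the constant and in the rate.

  Log-concavity enters through one consequence: the tail \<open>s \<mapsto> P (X \<ge> s)\<close> is a log-concave
  function.  This is the Prekopa--Leindler inequality for the density restricted to half-spaces
  (\<open>log_concave_half_space\<close>).  The midpoint form of that inequality is enough: it follows on the line
  from the Brunn--Minkowski inequality for level sets, and in higher dimension by integrating out one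
  coordinate at a time (\<open>prekopa_leindler\<close>).

  A log-concave tail that starts at a point where it is at least \<open>1/2\<close> and that is still large at a far
  point must lie above an exponential in between.  If that exponential decays too slowly, the second
  moment of \<open>X + 1\<close> becomes larger than 2, its actual value.
\<close>

section \<open>The Brunn--Minkowski inequality on the line\<close>

text \<open>
  If \<^term>\<open>A\<close> has a largest element this is trivial.  Otherwise \<^term>\<open>A\<close> is the increasing union of its
  intersections with the half-lines below the terms of a sequence that tends to its supremum, and
  each of these terms lies below some element of \<^term>\<open>A\<close>.  The half-lines end at elements of \<^term>\<open>A\<close> so that rescaled
  copies of two such sets can later be made to touch at a common midpoint.
\<close>
lemma emeasure_eq_SUP_atMost:
  fixes A :: "real set"
  assumes A: "A \<in> sets borel" and ne: "A \<noteq> {}"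
  shows "emeasure lborel A = (SUP a\<in>A. emeasure lborel (A \<inter> {..a}))"
proof (rule antisym)
  show "(SUP a\<in>A. emeasure lborel (A \<inter> {..a})) \<le> emeasure lborel A"
    using A by (intro SUP_least emeasure_mono) auto
  show "emeasure lborel A \<le> (SUP a\<in>A. emeasure lborel (A \<inter> {..a}))"
  proof (cases "\<exists>m\<in>A. \<forall>a\<in>A. a \<le> m")
    case True
    then obtain m where m: "m \<in> A" "A \<inter> {..m} = A" by auto
    show ?thesis by (rule SUP_upper2[OF m(1)]) (simp add: m(2))
  next
    case False
    then have no_max: "\<exists>b\<in>A. a < b" if "a \<in> A" for a using that by force
    obtain q :: "nat \<Rightarrow> real" where q: "incseq q" "\<And>n. \<exists>a\<in>A. q n \<le> a" "\<And>a. a \<in> A \<Longrightarrow> \<exists>n. a \<le> q n"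
    proof (cases "bdd_above A")
      case True
      show thesis
      proof (rule that[of "\<lambda>n. Sup A - 1 / real (Suc n)"])
        show "incseq (\<lambda>n. Sup A - 1 / real (Suc n))"
          by (intro monoI) (simp add: frac_le)
        show "\<exists>a\<in>A. Sup A - 1 / real (Suc n) \<le> a" for n
          using less_cSup_iff[OF ne True, of "Sup A - 1 / real (Suc n)"]
          by (auto intro: less_imp_le)
        fix a assume "a \<in> A"
        then obtain b where "b \<in> A" "a < b" using no_max by blast
        then have "a < Sup A" using True by (meson cSup_upper less_le_trans)
        then obtain n where "inverse (real (Suc n)) < Sup A - a"
          using reals_Archimedean[of "Sup A - a"] by auto
        then show "\<exists>n. a \<le> Sup A - 1 / real (Suc n)"
          by (intro exI[of _ n]) (simp add: inverse_eq_divide)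
      qed
    next
      case False
      show thesis
      proof (rule that[of real])
        show "incseq real" by (simp add: incseq_def)
        show "\<exists>a\<in>A. real n \<le> a" for n using False unfolding bdd_above_def by (meson linear)
        show "\<exists>n. a \<le> real n" for a by (rule real_arch_simple)
      qed
    qed
    have "(\<Union>n. A \<inter> {..q n}) = A" using q(3) by auto
    then have "emeasure lborel A = emeasure lborel (\<Union>n. A \<inter> {..q n})" by simp
    also have "\<dots> = (SUP n. emeasure lborel (A \<inter> {..q n}))"
      using A q(1) by (intro SUP_emeasure_incseq[symmetric]) (auto simp: incseq_def intro: order_trans)
    also have "\<dots> \<le> (SUP a\<in>A. emeasure lborel (A \<inter> {..a}))"
    proof (rule SUP_mono)
      fix n
      obtain a where "a \<in> A" "q n \<le> a" using q(2) by blast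
      then show "\<exists>a\<in>A. emeasure lborel (A \<inter> {..q n}) \<le> emeasure lborel (A \<inter> {..a})"
        using A by (intro bexI[of _ a] emeasure_mono) auto
    qed
    finally show ?thesis .
  qed
qed

lemma emeasure_lborel_uminus:
  fixes B :: "real set"
  assumes "B \<in> sets borel"
  shows "emeasure lborel (uminus -` B) = emeasure lborel B"
proof -
  have "emeasure lborel B = emeasure (distr lborel borel uminus) B" by (simp add: lborel_distr_uminus)
  then show ?thesis using assms by (simp add: emeasure_distr)
qed

lemma emeasure_eq_SUP_atLeast:
  fixes B :: "real set"
  assumes B: "B \<in> sets borel" and ne: "B \<noteq> {}"
  shows "emeasure lborel B = (SUP b\<in>B. emeasure lborel (B \<inter> {b..}))"
proof -
  have B': "uminus -` B \<in> sets borel"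
    using measurable_sets[of uminus borel borel B] B by simp
  have img: "uminus -` B = uminus ` B" by (auto simp: image_iff) (metis minus_minus)
  have ne': "uminus -` B \<noteq> {}" using ne by (simp add: img)
  have *: "emeasure lborel (uminus -` B \<inter> {..- b}) = emeasure lborel (B \<inter> {b..})" for b
  proof -
    have "uminus -` B \<inter> {..- b} = uminus -` (B \<inter> {b..})" by auto
    then show ?thesis using B emeasure_lborel_uminus[of "B \<inter> {b..}"] by simp
  qed
  have "emeasure lborel B = (SUP a\<in>uminus -` B. emeasure lborel (uminus -` B \<inter> {..a}))"
    using emeasure_eq_SUP_atMost[OF B' ne'] emeasure_lborel_uminus[OF B] by simp
  also have "\<dots> = (SUP b\<in>B. emeasure lborel (B \<inter> {b..}))"
    unfolding img image_image by (simp add: img[symmetric] *)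
  finally show ?thesis .
qed

text \<open>The set on the left is the image of \<^term>\<open>C\<close> under the dilation \<open>x \<mapsto> 2 x - b\<close>.\<close>
lemma emeasure_midpoints:
  fixes C :: "real set"
  assumes [measurable]: "C \<in> sets borel"
  shows "emeasure lborel {y. (y + b) / 2 \<in> C} = 2 * emeasure lborel C"
proof -
  have eq: "-b + 2 * x = y \<longleftrightarrow> x = (y + b) / 2" for x y :: real by auto
  have "emeasure lborel {y. (y + b) / 2 \<in> C} = (\<integral>\<^sup>+y. indicator {y. (y + b) / 2 \<in> C} y \<partial>lborel)"
    by (subst nn_integral_indicator) auto
  also have "\<dots> = ennreal \<bar>2\<bar> * (\<integral>\<^sup>+x. indicator {y. (y + b) / 2 \<in> C} (-b + 2 * x) \<partial>lborel)"
    by (rule nn_integral_real_affine) auto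
  also have "(\<lambda>x. indicator {y. (y + b) / 2 \<in> C} (-b + 2 * x) :: ennreal) = indicator C"
    by (auto simp: indicator_def)
  finally show ?thesis by simp
qed

text \<open>
  For \<^term>\<open>a \<in> A\<close> and \<^term>\<open>b \<in> B\<close> the set \<^term>\<open>C\<close> contains a half-size copy of the part of \<^term>\<open>A\<close> below \<^term>\<open>a\<close>
  (midpoints with \<^term>\<open>b\<close>) and a half-size copy of the part of \<^term>\<open>B\<close> above \<^term>\<open>b\<close> (midpoints with
  \<^term>\<open>a\<close>).  The two copies lie on opposite sides of the midpoint of \<^term>\<open>a\<close> and \<^term>\<open>b\<close>, so their lengths
  add up.  Taking suprema over \<^term>\<open>a\<close> and \<^term>\<open>b\<close> finishes the proof.
\<close>
lemma brunn_minkowski_real: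
  fixes A B C :: "real set"
  assumes [measurable]: "A \<in> sets borel" "B \<in> sets borel" "C \<in> sets borel"
    and ne: "A \<noteq> {}" "B \<noteq> {}"
    and mid: "\<And>a b. a \<in> A \<Longrightarrow> b \<in> B \<Longrightarrow> (a + b) / 2 \<in> C"
  shows "emeasure lborel A + emeasure lborel B \<le> 2 * emeasure lborel C"
proof -
  have touch: "emeasure lborel (A \<inter> {..a}) + emeasure lborel (B \<inter> {b..}) \<le> 2 * emeasure lborel C"
    if ab: "a \<in> A" "b \<in> B" for a b
  proof -
    define c where "c = (a + b) / 2"
    have "emeasure lborel (A \<inter> {..a}) \<le> emeasure lborel {y. (y + b) / 2 \<in> C \<inter> {..c}}"
      using mid ab by (intro emeasure_mono) (auto simp: c_def)
    then have 1: "emeasure lborel (A \<inter> {..a}) \<le> 2 * emeasure lborel (C \<inter> {..c})"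
      by (subst (asm) emeasure_midpoints) auto
    have "emeasure lborel (B \<inter> {b..}) \<le> emeasure lborel {y. (y + a) / 2 \<in> C \<inter> {c..}}"
      using mid[OF ab(1)] by (intro emeasure_mono) (auto simp: c_def add.commute)
    then have 2: "emeasure lborel (B \<inter> {b..}) \<le> 2 * emeasure lborel (C \<inter> {c..})"
      by (subst (asm) emeasure_midpoints) auto
    have "emeasure lborel (C \<inter> {c..}) \<le> emeasure lborel (C \<inter> {c<..} \<union> {c})"
      by (intro emeasure_mono) auto
    also have "\<dots> \<le> emeasure lborel (C \<inter> {c<..}) + emeasure lborel {c}"
      by (intro emeasure_subadditive) auto
    finally have "emeasure lborel (C \<inter> {c..}) \<le> emeasure lborel (C \<inter> {c<..})" by simp
    then have "emeasure lborel (C \<inter> {..c}) + emeasure lborel (C \<inter> {c..})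
        \<le> emeasure lborel (C \<inter> {..c}) + emeasure lborel (C \<inter> {c<..})"
      by (rule add_left_mono)
    also have "\<dots> = emeasure lborel ((C \<inter> {..c}) \<union> (C \<inter> {c<..}))"
      by (intro plus_emeasure) auto
    also have "(C \<inter> {..c}) \<union> (C \<inter> {c<..}) = C" by auto
    finally have "2 * (emeasure lborel (C \<inter> {..c}) + emeasure lborel (C \<inter> {c..})) \<le> 2 * emeasure lborel C"
      by (intro mult_left_mono) auto
    with add_mono[OF 1 2] show ?thesis by (simp add: distrib_left)
  qed
  have "emeasure lborel A + emeasure lborel B
      = (SUP a\<in>A. emeasure lborel (A \<inter> {..a}) + emeasure lborel B)"
    using ne by (simp add: emeasure_eq_SUP_atMost[of A] ennreal_SUP_add_left)
  also have "\<dots> \<le> 2 * emeasure lborel C"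
  proof (rule SUP_least)
    fix a assume a: "a \<in> A"
    have "emeasure lborel (A \<inter> {..a}) + emeasure lborel B
        = (SUP b\<in>B. emeasure lborel (A \<inter> {..a}) + emeasure lborel (B \<inter> {b..}))"
      using ne by (simp add: emeasure_eq_SUP_atLeast[of B] ennreal_SUP_add_right)
    also have "\<dots> \<le> 2 * emeasure lborel C"
      using touch[OF a] by (intro SUP_least)
    finally show "emeasure lborel (A \<inter> {..a}) + emeasure lborel B \<le> 2 * emeasure lborel C" .
  qed
  finally show ?thesis .
qed

section \<open>The Prekopa--Leindler inequality for midpoints\<close>

lemma (in sigma_finite_measure) nn_integral_layer_cake:
  assumes [measurable]: "f \<in> borel_measurable M"
  shows "(\<integral>\<^sup>+x. f x \<partial>M) = (\<integral>\<^sup>+t. indicator {0..} t * emeasure M {x \<in> space M. ennreal t < f x} \<partial>lborel)"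
proof -
  interpret P: pair_sigma_finite M "lborel :: real measure" ..
  have layer: "(\<integral>\<^sup>+t. indicator {t. 0 \<le> t \<and> ennreal t < c} t \<partial>lborel) = c" for c :: ennreal
  proof (cases c)
    case (real r)
    then have "{t. 0 \<le> t \<and> ennreal t < c} = {0..<r}" by (auto simp: ennreal_less_iff)
    with real show ?thesis by simp
  next
    case top
    then have eq: "{t::real. 0 \<le> t \<and> ennreal t < c} = {0..}" by auto
    have "emeasure lborel {0..real n} \<le> emeasure lborel {0::real..}" for n
      by (intro emeasure_mono) auto
    then have "of_nat n \<le> emeasure lborel {0::real..}" for n by (simp add: ennreal_of_nat_eq_real_of_nat)
    then have "emeasure lborel {0::real..} = top"
      by (metis ennreal_SUP_of_nat_eq_top top.extremum_uniqueI SUP_least)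
    then show ?thesis using top eq by (simp add: eq[simplified])
  qed
  have "(\<integral>\<^sup>+x. f x \<partial>M) = (\<integral>\<^sup>+x. (\<integral>\<^sup>+t. indicator {t. 0 \<le> t \<and> ennreal t < f x} t \<partial>lborel) \<partial>M)"
    by (simp only: layer)
  also have "\<dots> = (\<integral>\<^sup>+t. (\<integral>\<^sup>+x. indicator {t. 0 \<le> t \<and> ennreal t < f x} t \<partial>M) \<partial>lborel)"
    by (rule P.Fubini'[symmetric]) simp
  also have "\<dots> = (\<integral>\<^sup>+t. (\<integral>\<^sup>+x. indicator {0..} t * indicator {x \<in> space M. ennreal t < f x} x \<partial>M) \<partial>lborel)"
    by (intro nn_integral_cong) (auto simp: indicator_def)
  also have "\<dots> = (\<integral>\<^sup>+t. indicator {0..} t * emeasure M {x \<in> space M. ennreal t < f x} \<partial>lborel)"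
    by (simp add: nn_integral_cmult)
  finally show ?thesis .
qed

text \<open>
  The normalization makes every level set of \<^term>\<open>f\<close> and of \<^term>\<open>g\<close> below height 1 nonempty, so that the
  Brunn--Minkowski inequality applies at each such level \<^term>\<open>t\<close>: if \<open>t < f x\<close> and \<open>t < g y\<close> then
  \<open>t\<^sup>2 < (h ((x + y) / 2))\<^sup>2\<close>.  From height 1 on, the level sets of \<^term>\<open>f\<close> and \<^term>\<open>g\<close> are empty.
  Integrating over the levels gives the claim.
\<close>
lemma prekopa_leindler_real_normalized:
  fixes f g h :: "real \<Rightarrow> ennreal"
  assumes [measurable]: "f \<in> borel_measurable borel" "g \<in> borel_measurable borel" "h \<in> borel_measurable borel"
    and mid: "\<And>x y. f x * g y \<le> (h ((x + y) / 2))\<^sup>2"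
    and sup: "(SUP x. f x) = 1" "(SUP x. g x) = 1"
  shows "(\<integral>\<^sup>+x. f x \<partial>lborel) + (\<integral>\<^sup>+x. g x \<partial>lborel) \<le> 2 * (\<integral>\<^sup>+x. h x \<partial>lborel)"
proof -
  have le1: "f x \<le> 1" "g x \<le> 1" for x
    using sup by (metis SUP_upper UNIV_I)+
  have level: "emeasure lborel {x. ennreal t < f x} + emeasure lborel {x. ennreal t < g x}
      \<le> 2 * emeasure lborel {x. ennreal t < h x}" if t: "0 \<le> t" for t
  proof (cases "t < 1")
    case True
    then have t1: "ennreal t < 1" using t by (simp add: ennreal_less_one_iff)
    show ?thesis
    proof (rule brunn_minkowski_real)
      show "{x. ennreal t < f x} \<noteq> {}" "{x. ennreal t < g x} \<noteq> {}"
        using t1 less_SUP_iff[of "ennreal t" f UNIV] less_SUP_iff[of "ennreal t" g UNIV] by (auto simp: sup)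
      fix x y assume xy: "x \<in> {x. ennreal t < f x}" "y \<in> {x. ennreal t < g x}"
      show "(x + y) / 2 \<in> {x. ennreal t < h x}"
      proof (rule ccontr)
        assume "(x + y) / 2 \<notin> {x. ennreal t < h x}"
        then have "h ((x + y) / 2) \<le> ennreal t" by simp
        then have "(h ((x + y) / 2))\<^sup>2 \<le> (ennreal t)\<^sup>2" by (intro power_mono) auto
        with mid[of x y] have le: "f x * g y \<le> (ennreal t)\<^sup>2" by (rule order_trans)
        obtain u where u: "f x = ennreal u" "0 \<le> u"
          using le1(1)[of x] by (cases "f x") (auto simp: top_unique)
        obtain v where v: "g y = ennreal v" "0 \<le> v"
          using le1(2)[of y] by (cases "g y") (auto simp: top_unique)
        have "t < u" "t < v" using xy t u v by (auto simp: ennreal_less_iff)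
        then have "t * t < u * v" using t by (intro mult_strict_mono') auto
        moreover have "u * v \<le> t * t"
          using le u v t by (simp add: ennreal_mult[symmetric] power2_eq_square)
        ultimately show False by simp
      qed
    qed auto
  next
    case False
    then have "1 \<le> ennreal t" using t by (simp add: ennreal_ge_1)
    then have "f x \<le> ennreal t" "g x \<le> ennreal t" for x using le1[of x] order_trans by blast+
    then have "{x. ennreal t < f x} = {}" "{x. ennreal t < g x} = {}" by (auto simp: not_less)
    then show ?thesis by simp
  qed
  let ?L = "\<lambda>f :: real \<Rightarrow> ennreal. \<lambda>t. indicator {0..} t * emeasure lborel {x. ennreal t < f x}"
  have cake: "(\<integral>\<^sup>+x. \<phi> x \<partial>lborel) = (\<integral>\<^sup>+t. ?L \<phi> t \<partial>lborel)"
    if "\<phi> \<in> borel_measurable borel" for \<phi> :: "real \<Rightarrow> ennreal"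
    using sigma_finite_measure.nn_integral_layer_cake[OF lborel.sigma_finite_measure_axioms, of \<phi>] that by simp
  have m: "?L \<phi> \<in> borel_measurable borel"
    if [measurable]: "\<phi> \<in> borel_measurable borel" for \<phi> :: "real \<Rightarrow> ennreal"
  proof -
    have "(\<lambda>t. indicator {0..} t * (\<integral>\<^sup>+x. indicator {x. ennreal t < \<phi> x} x \<partial>lborel)) \<in> borel_measurable borel"
      by measurable
    then show ?thesis by simp
  qed
  have "(\<integral>\<^sup>+x. f x \<partial>lborel) + (\<integral>\<^sup>+x. g x \<partial>lborel) = (\<integral>\<^sup>+t. ?L f t + ?L g t \<partial>lborel)"
    using m[of f] m[of g] by (subst cake[of f], simp, subst cake[of g]) (simp_all add: nn_integral_add)
  also have "\<dots> \<le> (\<integral>\<^sup>+t. 2 * ?L h t \<partial>lborel)"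
    using level by (intro nn_integral_mono) (auto simp: indicator_def)
  also have "\<dots> = 2 * (\<integral>\<^sup>+x. h x \<partial>lborel)"
    using m[of h] by (subst cake[of h]) (simp_all add: nn_integral_cmult)
  finally show ?thesis .
qed

text \<open>
  Dividing by the suprema \<^term>\<open>a\<close> and \<^term>\<open>b\<close>, and \<^term>\<open>h\<close> by their geometric mean, reduces to the
  normalized case; its additive conclusion becomes multiplicative through the inequality between
  arithmetic and geometric mean.
\<close>
lemma prekopa_leindler_real_bounded:
  fixes f g h :: "real \<Rightarrow> ennreal"
  assumes [measurable]: "f \<in> borel_measurable borel" "g \<in> borel_measurable borel" "h \<in> borel_measurable borel"
    and mid: "\<And>x y. f x * g y \<le> (h ((x + y) / 2))\<^sup>2"
    and sup: "(SUP x. f x) = ennreal a" "(SUP x. g x) = ennreal b" "0 < a" "0 < b"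
  shows "(\<integral>\<^sup>+x. f x \<partial>lborel) * (\<integral>\<^sup>+x. g x \<partial>lborel) \<le> (\<integral>\<^sup>+x. h x \<partial>lborel)\<^sup>2"
proof -
  define c where "c = 1 / sqrt (a * b)"
  have c: "0 < c" "c * c = (1 / a) * (1 / b)" using sup by (auto simp: c_def)
  have sum: "(\<integral>\<^sup>+x. ennreal (1 / a) * f x \<partial>lborel) + (\<integral>\<^sup>+x. ennreal (1 / b) * g x \<partial>lborel)
      \<le> 2 * (\<integral>\<^sup>+x. ennreal c * h x \<partial>lborel)"
  proof (rule prekopa_leindler_real_normalized)
    fix x y
    have "ennreal (c * c) = ennreal (1 / a) * ennreal (1 / b)"
      using sup by (simp only: c) (rule ennreal_mult, auto)
    then have "ennreal (1 / a) * f x * (ennreal (1 / b) * g y) = ennreal (c * c) * (f x * g y)"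
      by (simp only: mult_ac)
    also have "\<dots> \<le> ennreal (c * c) * (h ((x + y) / 2))\<^sup>2" by (intro mult_left_mono mid) auto
    also have "\<dots> = (ennreal c * h ((x + y) / 2))\<^sup>2"
      using c(1) by (simp add: ennreal_mult power2_eq_square mult_ac)
    finally show "ennreal (1 / a) * f x * (ennreal (1 / b) * g y) \<le> (ennreal c * h ((x + y) / 2))\<^sup>2" .
  qed (use sup in \<open>auto simp: SUP_mult_left_ennreal[symmetric] ennreal_mult[symmetric]\<close>)
  define F G H where "F = (\<integral>\<^sup>+x. f x \<partial>lborel)" "G = (\<integral>\<^sup>+x. g x \<partial>lborel)" "H = (\<integral>\<^sup>+x. h x \<partial>lborel)"
  have sum': "ennreal (1 / a) * F + ennreal (1 / b) * G \<le> 2 * (ennreal c * H)"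
    using sum by (simp add: nn_integral_cmult F_G_H_def)
  show ?thesis unfolding F_G_H_def[symmetric]
  proof (cases H)
    case top
    then show "F * G \<le> H\<^sup>2" by simp
  next
    case H: (real w)
    have fin: "2 * (ennreal c * H) < top" using H by (simp add: ennreal_mult_less_top)
    then have "ennreal (1 / a) * F < top" "ennreal (1 / b) * G < top"
      using sum' by (auto simp: less_top[symmetric] top_unique)
    then have "F < top" "G < top" using sup by (auto simp: ennreal_mult_less_top)
    then obtain u v where uv: "F = ennreal u" "0 \<le> u" "G = ennreal v" "0 \<le> v"
      by (cases F; cases G) auto
    have "ennreal (u / a + v / b) = ennreal (1 / a) * F + ennreal (1 / b) * G"
      using uv sup by (simp add: ennreal_mult[symmetric])
    also have "\<dots> \<le> 2 * (ennreal c * H)" by (rule sum')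
    also have "\<dots> = ennreal (2 * (c * w))" using H c by (simp add: ennreal_mult)
    finally have le: "u / a + v / b \<le> 2 * (c * w)" using H c by (subst (asm) ennreal_le_iff) auto
    have "4 * ((u / a) * (v / b)) \<le> (u / a + v / b)\<^sup>2"
      using sum_squares_bound[of "u / a" "v / b"] by (simp add: power2_sum)
    also have "\<dots> \<le> (2 * (c * w))\<^sup>2" using le uv sup by (intro power_mono) auto
    also have "\<dots> = 4 * (c * c) * w\<^sup>2" by (simp add: power2_eq_square)
    also have "\<dots> = 4 * (w\<^sup>2 / (a * b))" by (simp add: c)
    finally have "u * v \<le> w\<^sup>2" using sup by (simp add: divide_simps)
    then show "F * G \<le> H\<^sup>2" using uv H by (simp add: ennreal_mult[symmetric] ennreal_power)
  qed
qed

lemma prekopa_leindler_real: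
  fixes f g h :: "real \<Rightarrow> ennreal"
  assumes [measurable]: "f \<in> borel_measurable borel" "g \<in> borel_measurable borel" "h \<in> borel_measurable borel"
    and mid: "\<And>x y. f x * g y \<le> (h ((x + y) / 2))\<^sup>2"
  shows "(\<integral>\<^sup>+x. f x \<partial>lborel) * (\<integral>\<^sup>+x. g x \<partial>lborel) \<le> (\<integral>\<^sup>+x. h x \<partial>lborel)\<^sup>2"
proof -
  have trunc: "(\<integral>\<^sup>+x. min (f x) (of_nat m) \<partial>lborel) * (\<integral>\<^sup>+x. min (g x) (of_nat n) \<partial>lborel)
      \<le> (\<integral>\<^sup>+x. h x \<partial>lborel)\<^sup>2" for m n :: nat
  proof -
    define a b where "a = (SUP x. min (f x) (of_nat m))" "b = (SUP x. min (g x) (of_nat n))"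
    have "a \<le> of_nat m" "b \<le> of_nat n" unfolding a_b_def by (auto intro: SUP_least)
    then have "a < top" "b < top"
      by (meson of_nat_less_top le_less_trans)+
    then obtain a' b' where ab: "a = ennreal a'" "0 \<le> a'" "b = ennreal b'" "0 \<le> b'"
      by (cases a; cases b) auto
    show ?thesis
    proof (cases "a' = 0 \<or> b' = 0")
      case True
      then have "(\<forall>x. min (f x) (of_nat m) = 0) \<or> (\<forall>x. min (g x) (of_nat n) = 0)"
        using ab unfolding a_b_def by (auto simp: SUP_eq_iff bot_ennreal[symmetric])
      then show ?thesis by auto
    next
      case False
      show ?thesis
      proof (rule prekopa_leindler_real_bounded)
        fix x y
        have "min (f x) (of_nat m) * min (g y) (of_nat n) \<le> f x * g y" by (intro mult_mono) auto
        then show "min (f x) (of_nat m) * min (g y) (of_nat n) \<le> (h ((x + y) / 2))\<^sup>2"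
          using mid order_trans by blast
      qed (use ab False in \<open>auto simp: a_b_def\<close>)
    qed
  qed
  have lim: "(\<integral>\<^sup>+x. \<phi> x \<partial>lborel) = (SUP n. \<integral>\<^sup>+x. min (\<phi> x) (of_nat n) \<partial>lborel)"
    if [measurable]: "\<phi> \<in> borel_measurable borel" for \<phi> :: "real \<Rightarrow> ennreal"
  proof -
    have "(SUP n. min (\<phi> x) (of_nat n)) = \<phi> x" for x
      by (simp add: inf_min[symmetric] inf_SUP[symmetric] ennreal_SUP_of_nat_eq_top)
    then have "(\<integral>\<^sup>+x. \<phi> x \<partial>lborel) = (\<integral>\<^sup>+x. (SUP n. min (\<phi> x) (of_nat n)) \<partial>lborel)" by simp
    also have "\<dots> = (SUP n. \<integral>\<^sup>+x. min (\<phi> x) (of_nat n) \<partial>lborel)"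
      by (intro nn_integral_monotone_convergence_SUP incseq_SucI le_funI min.mono) auto
    finally show ?thesis .
  qed
  have "(\<integral>\<^sup>+x. f x \<partial>lborel) * (\<integral>\<^sup>+x. g x \<partial>lborel)
      = (SUP n. SUP m. (\<integral>\<^sup>+x. min (f x) (of_nat m) \<partial>lborel) * (\<integral>\<^sup>+x. min (g x) (of_nat n) \<partial>lborel))"
    by (simp only: lim[OF assms(1)] lim[OF assms(2)] SUP_mult_left_ennreal SUP_mult_right_ennreal)
  also have "\<dots> \<le> (\<integral>\<^sup>+x. h x \<partial>lborel)\<^sup>2" by (intro SUP_least trunc)
  finally show ?thesis .
qed

text \<open>
  Induction on the number of coordinates: by the induction hypothesis, the integrals over all but
  one coordinate satisfy the hypothesis of the one-dimensional inequality.  The hypothesis is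
  stated for arbitrary functions rather than for points of the product space; this spares every
  side condition on extensionality, and functions outside the product space never enter the
  integrals.
\<close>
lemma prekopa_leindler_PiM:
  fixes f g h :: "('i \<Rightarrow> real) \<Rightarrow> ennreal"
  assumes "finite I"
    and "f \<in> borel_measurable (\<Pi>\<^sub>M i\<in>I. lborel)" "g \<in> borel_measurable (\<Pi>\<^sub>M i\<in>I. lborel)"
      "h \<in> borel_measurable (\<Pi>\<^sub>M i\<in>I. lborel)"
    and "\<And>x y. f x * g y \<le> (h (\<lambda>i. (x i + y i) / 2))\<^sup>2"
  shows "(\<integral>\<^sup>+x. f x \<partial>(\<Pi>\<^sub>M i\<in>I. lborel)) * (\<integral>\<^sup>+x. g x \<partial>(\<Pi>\<^sub>M i\<in>I. lborel))
    \<le> (\<integral>\<^sup>+x. h x \<partial>(\<Pi>\<^sub>M i\<in>I. lborel))\<^sup>2"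
  using assms
proof (induction I arbitrary: f g h)
  case empty
  \<comment> \<open>The only point of the empty product is the constant function \<^term>\<open>undefined\<close>, its own midpoint.\<close>
  have "(\<lambda>i. (undefined + undefined) / 2) = (\<lambda>i::'i. undefined :: real)" by auto
  with empty(4)[of "\<lambda>_. undefined" "\<lambda>_. undefined"]
  show ?case by (simp add: PiM_empty nn_integral_count_space_finite)
next
  case (insert i I)
  interpret product_sigma_finite "\<lambda>_::'i. lborel :: real measure" ..
  note [measurable] = insert.prems(1-3)
  have m: "(\<lambda>(s, x). \<phi> (x(i := s))) \<in> borel_measurable (lborel \<Otimes>\<^sub>M (\<Pi>\<^sub>M i\<in>I. lborel))"
    if [measurable]: "\<phi> \<in> borel_measurable (\<Pi>\<^sub>M i\<in>insert i I. lborel)" for \<phi> :: "('i \<Rightarrow> real) \<Rightarrow> ennreal"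
    by measurable
  have m1: "(\<lambda>x. \<phi> (x(i := s))) \<in> borel_measurable (\<Pi>\<^sub>M i\<in>I. lborel)"
    if "\<phi> \<in> borel_measurable (\<Pi>\<^sub>M i\<in>insert i I. lborel)" for \<phi> :: "('i \<Rightarrow> real) \<Rightarrow> ennreal" and s
    using measurable_compose_Pair1[OF _ m[OF that], of s] by simp
  have m2: "(\<lambda>s. \<integral>\<^sup>+x. \<phi> (x(i := s)) \<partial>(\<Pi>\<^sub>M i\<in>I. lborel)) \<in> borel_measurable borel"
    if "\<phi> \<in> borel_measurable (\<Pi>\<^sub>M i\<in>insert i I. lborel)" for \<phi> :: "('i \<Rightarrow> real) \<Rightarrow> ennreal"
  proof -
    interpret J: sigma_finite_measure "\<Pi>\<^sub>M i\<in>I. (lborel :: real measure)"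
      using insert.hyps(1) by (rule sigma_finite)
    show ?thesis using J.borel_measurable_nn_integral[OF m[OF that]] by simp
  qed
  show ?case
    unfolding product_nn_integral_insert_rev[OF insert.hyps insert.prems(1)]
      product_nn_integral_insert_rev[OF insert.hyps insert.prems(2)]
      product_nn_integral_insert_rev[OF insert.hyps insert.prems(3)]
  proof (rule prekopa_leindler_real)
    fix s t :: real
    show "(\<integral>\<^sup>+x. f (x(i := s)) \<partial>(\<Pi>\<^sub>M i\<in>I. lborel)) * (\<integral>\<^sup>+x. g (x(i := t)) \<partial>(\<Pi>\<^sub>M i\<in>I. lborel))
        \<le> (\<integral>\<^sup>+x. h (x(i := (s + t) / 2)) \<partial>(\<Pi>\<^sub>M i\<in>I. lborel))\<^sup>2"
    proof (rule insert.IH)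
      fix x y :: "'i \<Rightarrow> real"
      have mid_upd: "(\<lambda>j. ((x(i := s)) j + (y(i := t)) j) / 2) = (\<lambda>j. (x j + y j) / 2)(i := (s + t) / 2)"
        by auto
      show "f (x(i := s)) * g (y(i := t)) \<le> (h ((\<lambda>j. (x j + y j) / 2)(i := (s + t) / 2)))\<^sup>2"
        using insert.prems(4)[of "x(i := s)" "y(i := t)"] unfolding mid_upd .
    qed (intro m1 insert.prems)+
  qed (intro m2 insert.prems)+
qed

text \<open>
  Midpoints in place of general convex combinations, and squares in place of real powers, keep the
  inequality meaningful for functions with values in \<^typ>\<open>ennreal\<close>.
\<close>
theorem prekopa_leindler:
  fixes f g h :: "'a::euclidean_space \<Rightarrow> ennreal"
  assumes [measurable]: "f \<in> borel_measurable borel" "g \<in> borel_measurable borel" "h \<in> borel_measurable borel"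
    and mid: "\<And>x y. f x * g y \<le> (h ((1/2) *\<^sub>R x + (1/2) *\<^sub>R y))\<^sup>2"
  shows "(\<integral>\<^sup>+x. f x \<partial>lborel) * (\<integral>\<^sup>+x. g x \<partial>lborel) \<le> (\<integral>\<^sup>+x. h x \<partial>lborel)\<^sup>2"
proof -
  let ?v = "\<lambda>x :: 'a \<Rightarrow> real. \<Sum>b\<in>Basis. x b *\<^sub>R b"
  have v: "?v \<in> (\<Pi>\<^sub>M b\<in>Basis. lborel) \<rightarrow>\<^sub>M borel" by measurable
  have eq: "(lborel :: 'a measure) = distr (\<Pi>\<^sub>M b\<in>Basis. lborel) borel ?v"
    unfolding lborel_eq_real by (rule lborel_def)
  have int: "(\<integral>\<^sup>+x. \<phi> x \<partial>lborel) = (\<integral>\<^sup>+x. \<phi> (?v x) \<partial>(\<Pi>\<^sub>M b\<in>Basis. lborel))"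
    if "\<phi> \<in> borel_measurable borel" for \<phi> :: "'a \<Rightarrow> ennreal"
    using that v by (subst eq) (simp add: nn_integral_distr)
  show ?thesis unfolding int[OF assms(1)] int[OF assms(2)] int[OF assms(3)]
  proof (rule prekopa_leindler_PiM)
    fix x y :: "'a \<Rightarrow> real"
    have "?v (\<lambda>b. (x b + y b) / 2) = (1/2) *\<^sub>R ?v x + (1/2) *\<^sub>R ?v y"
      unfolding scaleR_sum_right sum.distrib[symmetric]
      by (intro sum.cong) (simp_all add: scaleR_add_left add_divide_distrib)
    then show "f (?v x) * g (?v y) \<le> (h (?v (\<lambda>b. (x b + y b) / 2)))\<^sup>2" using mid by simp
  qed (use v in \<open>simp_all add: measurable_compose[OF _ assms(1)] measurable_compose[OF _ assms(2)] measurable_compose[OF _ assms(3)]\<close>)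
qed

section \<open>Log-concavity of the tails of a marginal\<close>

lemma exp_minus_midpoint:
  assumes "convex_ereal V"
  shows "exp_minus (V x) * exp_minus (V y) \<le> (exp_minus (V ((1/2) *\<^sub>R x + (1/2) *\<^sub>R y)))\<^sup>2"
proof (cases "V x = \<infinity> \<or> V y = \<infinity>")
  case True
  have "exp_minus \<infinity> = 0" unfolding infinity_ereal_def by (rule exp_minus.simps(2))
  with True show ?thesis by auto
next
  case False
  let ?m = "(1/2) *\<^sub>R x + (1/2) *\<^sub>R y"
  have fin: "V z \<noteq> -\<infinity>" for z using assms by (simp add: convex_ereal_def)
  obtain r r' where r: "V x = ereal r" "V y = ereal r'"
    using False fin[of x] fin[of y] by (cases "V x"; cases "V y") auto
  have "V ?m \<le> ereal (1/2) * V x + ereal (1/2) * V y"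
    using assms unfolding convex_ereal_def by (metis field_sum_of_halves zero_le_divide_1_iff zero_le_numeral)
  then have le: "V ?m \<le> ereal ((r + r') / 2)" by (simp add: r add_divide_distrib)
  obtain w where w: "V ?m = ereal w"
    using le fin[of ?m] by (cases "V ?m") auto
  have "exp (- r) * exp (- r') \<le> (exp (- w))\<^sup>2"
    using le by (simp add: w exp_add[symmetric] power2_eq_square)
  then show ?thesis by (simp add: r w ennreal_mult[symmetric] ennreal_power)
qed

text \<open>
  The midpoint of a point in the half-space at height \<^term>\<open>s\<close> and a point in the half-space at height
  \<^term>\<open>t\<close> lies in the half-space at height \<open>(s + t) / 2\<close>.  Hence the restrictions of the density to
  these half-spaces satisfy the hypothesis of the Prekopa--Leindler inequality.
\<close>
lemma (in prob_space) log_concave_half_space: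
  fixes Z :: "'a \<Rightarrow> real ^ 'n"
  assumes "log_concave M Z"
  shows "prob {\<omega> \<in> space M. s \<le> Z \<omega> \<bullet> \<theta>} * prob {\<omega> \<in> space M. t \<le> Z \<omega> \<bullet> \<theta>}
    \<le> (prob {\<omega> \<in> space M. (s + t) / 2 \<le> Z \<omega> \<bullet> \<theta>})\<^sup>2"
proof -
  obtain V where V: "convex_ereal V" and Z: "distributed M lborel Z (\<lambda>x. exp_minus (V x))"
    using assms unfolding log_concave_def by blast
  have [measurable]: "(\<lambda>x. exp_minus (V x)) \<in> borel_measurable borel"
    using distributed_borel_measurable[OF Z] by simp
  have H: "ennreal (prob {\<omega> \<in> space M. s \<le> Z \<omega> \<bullet> \<theta>})
      = (\<integral>\<^sup>+x. exp_minus (V x) * indicator {x. s \<le> x \<bullet> \<theta>} x \<partial>lborel)" for s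
  proof -
    have "Z -` {x. s \<le> x \<bullet> \<theta>} \<inter> space M = {\<omega> \<in> space M. s \<le> Z \<omega> \<bullet> \<theta>}" by auto
    then show ?thesis
      using distributed_emeasure[OF Z, of "{x. s \<le> x \<bullet> \<theta>}"] by (simp add: emeasure_eq_measure)
  qed
  have "ennreal (prob {\<omega> \<in> space M. s \<le> Z \<omega> \<bullet> \<theta>}) * ennreal (prob {\<omega> \<in> space M. t \<le> Z \<omega> \<bullet> \<theta>})
    \<le> (ennreal (prob {\<omega> \<in> space M. (s + t) / 2 \<le> Z \<omega> \<bullet> \<theta>}))\<^sup>2"
    unfolding H
  proof (rule prekopa_leindler)
    fix x y :: "real ^ 'n"
    show "exp_minus (V x) * indicator {x. s \<le> x \<bullet> \<theta>} x * (exp_minus (V y) * indicator {x. t \<le> x \<bullet> \<theta>} y)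
      \<le> (exp_minus (V ((1/2) *\<^sub>R x + (1/2) *\<^sub>R y)) *
          indicator {x. (s + t) / 2 \<le> x \<bullet> \<theta>} ((1/2) *\<^sub>R x + (1/2) *\<^sub>R y))\<^sup>2"
      using exp_minus_midpoint[OF V, of x y] by (auto simp: indicator_def inner_add_left)
  qed measurable
  then show ?thesis by (simp add: ennreal_mult[symmetric] ennreal_power)
qed

text \<open>
  A concave function is bounded below by its values at the ends of an interval.  For midpoint
  concavity without continuity, let \<open>I\<close> be the infimum of \<^term>\<open>\<phi>\<close> on the interval.  Every point is the
  midpoint of one of the ends and some point of the interval, so \<open>\<phi>\<^sup>2 \<ge> q I\<close> throughout; hence
  \<open>I\<^sup>2 \<ge> q I\<close>, and positivity of \<open>I\<close> gives \<open>I \<ge> q\<close>.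
\<close>
lemma midpoint_log_concave_ge:
  fixes \<phi> :: "real \<Rightarrow> real"
  assumes mid: "\<And>x y. \<phi> x * \<phi> y \<le> (\<phi> ((x + y) / 2))\<^sup>2"
    and pos: "0 < \<delta>" "\<And>x. x \<in> {0..S} \<Longrightarrow> \<delta> \<le> \<phi> x"
    and ends: "0 \<le> q" "q \<le> \<phi> 0" "q \<le> \<phi> S"
    and x: "x \<in> {0..S}"
  shows "q \<le> \<phi> x"
proof -
  define I where "I = Inf (\<phi> ` {0..S})"
  have bdd: "bdd_below (\<phi> ` {0..S})" by (rule bdd_belowI2[OF pos(2)])
  have I_le: "I \<le> \<phi> y" if "y \<in> {0..S}" for y unfolding I_def by (rule cINF_lower[OF bdd that])
  have "\<delta> \<le> I" unfolding I_def using x pos(2) by (intro cINF_greatest) auto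
  then have I: "0 < I" using pos(1) by simp
  have half: "q * I \<le> (\<phi> y)\<^sup>2" if y: "y \<in> {0..S}" for y
  proof (cases "2 * y \<le> S")
    case True
    then have "q * I \<le> \<phi> 0 * \<phi> (2 * y)" using y ends I I_le[of "2 * y"] by (intro mult_mono) auto
    also have "\<dots> \<le> (\<phi> y)\<^sup>2" using mid[of 0 "2 * y"] by simp
    finally show ?thesis .
  next
    case False
    then have "q * I \<le> \<phi> S * \<phi> (2 * y - S)" using y ends I I_le[of "2 * y - S"] by (intro mult_mono) auto
    also have "\<dots> \<le> (\<phi> y)\<^sup>2" using mid[of S "2 * y - S"] by simp
    finally show ?thesis .
  qed
  have "sqrt (q * I) \<le> I"
    unfolding I_def using x
  proof (intro cINF_greatest)
    fix y assume y: "y \<in> {0..S}"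
    show "sqrt (q * Inf (\<phi> ` {0..S})) \<le> \<phi> y"
      using half[OF y] I_le[OF y] I unfolding I_def by (intro real_le_lsqrt) auto
  qed auto
  then have "q * I \<le> I * I" using I ends(1) by (metis mult_nonneg_nonneg less_imp_le power2_eq_square sqrt_le_D)
  then have "q \<le> I" using I by simp
  then show ?thesis using I_le[OF x] by simp
qed

section \<open>Exponential tails in dimension one\<close>

text \<open>
  Write the square of the positive part of \<^term>\<open>Y\<close> as the integral of \<open>2 x\<close> over \<open>0 \<le> x \<le> Y\<close> and
  exchange the order of integration.
\<close>
lemma (in prob_space) nn_integral_tail_le_second_moment:
  fixes Y :: "'a \<Rightarrow> real"
  assumes [measurable]: "Y \<in> borel_measurable M" and int: "integrable M (\<lambda>\<omega>. (Y \<omega>)\<^sup>2)"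
  shows "(\<integral>\<^sup>+x. ennreal (2 * x * prob {\<omega> \<in> space M. x \<le> Y \<omega>}) * indicator {0..S} x \<partial>lborel)
    \<le> ennreal (\<integral>\<omega>. (Y \<omega>)\<^sup>2 \<partial>M)"
proof -
  interpret P: pair_sigma_finite M "lborel :: real measure" ..
  let ?k = "\<lambda>\<omega> x. ennreal (2 * x) * indicator {0..S} x * indicator {..Y \<omega>} x"
  have "(\<integral>\<^sup>+x. ennreal (2 * x * prob {\<omega> \<in> space M. x \<le> Y \<omega>}) * indicator {0..S} x \<partial>lborel)
      = (\<integral>\<^sup>+x. (\<integral>\<^sup>+\<omega>. ?k \<omega> x \<partial>M) \<partial>lborel)"
  proof (intro nn_integral_cong)
    fix x :: real
    have "(\<integral>\<^sup>+\<omega>. ?k \<omega> x \<partial>M)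
        = (\<integral>\<^sup>+\<omega>. ennreal (2 * x) * indicator {0..S} x * indicator {\<omega> \<in> space M. x \<le> Y \<omega>} \<omega> \<partial>M)"
      by (intro nn_integral_cong) (auto simp: indicator_def)
    also have "\<dots> = ennreal (2 * x) * indicator {0..S} x * emeasure M {\<omega> \<in> space M. x \<le> Y \<omega>}"
      by (subst nn_integral_cmult) auto
    also have "\<dots> = ennreal (2 * x * prob {\<omega> \<in> space M. x \<le> Y \<omega>}) * indicator {0..S} x"
      by (auto simp: indicator_def emeasure_eq_measure ennreal_mult)
    finally show "ennreal (2 * x * prob {\<omega> \<in> space M. x \<le> Y \<omega>}) * indicator {0..S} x
        = (\<integral>\<^sup>+\<omega>. ?k \<omega> x \<partial>M)" ..
  qed
  also have "\<dots> = (\<integral>\<^sup>+\<omega>. (\<integral>\<^sup>+x. ?k \<omega> x \<partial>lborel) \<partial>M)"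
    by (rule P.Fubini') (simp add: indicator_def)
  also have "\<dots> \<le> (\<integral>\<^sup>+\<omega>. ennreal ((Y \<omega>)\<^sup>2) \<partial>M)"
  proof (intro nn_integral_mono)
    fix \<omega>
    show "(\<integral>\<^sup>+x. ?k \<omega> x \<partial>lborel) \<le> ennreal ((Y \<omega>)\<^sup>2)"
    proof (cases "0 \<le> Y \<omega>")
      case True
      have "(\<integral>\<^sup>+x. ?k \<omega> x \<partial>lborel) \<le> (\<integral>\<^sup>+x. ennreal (2 * x) * indicator {0..Y \<omega>} x \<partial>lborel)"
        by (intro nn_integral_mono) (auto simp: indicator_def)
      also have "\<dots> = ennreal ((Y \<omega>)\<^sup>2 - 0\<^sup>2)"
        using True by (intro nn_integral_FTC_Icc[where F = "\<lambda>x. x\<^sup>2"]) (auto intro!: derivative_eq_intros)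
      finally show ?thesis by simp
    next
      case False
      then have "(\<integral>\<^sup>+x. ?k \<omega> x \<partial>lborel) = (\<integral>\<^sup>+x. 0 \<partial>(lborel :: real measure))"
        by (intro nn_integral_cong) (auto simp: indicator_def)
      then show ?thesis by simp
    qed
  qed
  also have "\<dots> = ennreal (\<integral>\<omega>. (Y \<omega>)\<^sup>2 \<partial>M)" by (rule nn_integral_eq_integral[OF int]) simp
  finally show ?thesis .
qed

lemma nn_integral_linear_exponential:
  fixes r S :: real
  assumes "0 < r" "0 \<le> S"
  shows "(\<integral>\<^sup>+x. ennreal (x * exp (- r * x)) * indicator {0..S} x \<partial>lborel)
    = ennreal ((1 - (1 + r * S) * exp (- r * S)) / r\<^sup>2)"
proof -
  define F where "F = (\<lambda>x. - (1 + r * x) * exp (- r * x) / r\<^sup>2)"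
  have "(\<integral>\<^sup>+x. ennreal (x * exp (- r * x)) * indicator {0..S} x \<partial>lborel) = ennreal (F S - F 0)"
  proof (rule nn_integral_FTC_Icc)
    show "(F has_real_derivative x * exp (- r * x)) (at x)" for x
      unfolding F_def using assms
      by (auto intro!: derivative_eq_intros simp: field_simps power2_eq_square)
  qed (use assms in auto)
  also have "F S - F 0 = (1 - (1 + r * S) * exp (- r * S)) / r\<^sup>2"
    using assms by (simp add: F_def field_simps)
  finally show ?thesis .
qed

text \<open>
  Let \<open>H x\<close> be the probability of \<open>X + 1 \<ge> x\<close>.  Since \<open>X - 1\<close> has second moment 2, Chebyshev's inequality
  gives \<open>H 0 \<ge> 1/2\<close>.  If the claim fails at \<^term>\<open>s\<close>, then at \<open>S = s + 1\<close> the function \<open>H\<close> is still larger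
  than \<open>exp (- r S)\<close> for a rate \<open>r\<close> below \<open>1 / sqrt 3\<close>, and log-concavity forces
  \<open>H x \<ge> exp (- r x) / 2\<close> on the whole interval from 0 to \<open>S\<close>.  This makes the second moment of \<open>X + 1\<close>
  at least about \<open>1 / r\<^sup>2 > 3\<close> when \<open>S\<close> is large, whereas it equals 2.  The room between 3 and 2 pays
  for the truncation at finite \<open>S\<close>.  Measuring from \<open>-1\<close> instead of from the mean makes the lower bound
  \<open>1/2\<close> at the base point an instance of Chebyshev's inequality.
\<close>
lemma (in prob_space) log_concave_tail_bound:
  fixes X :: "'a \<Rightarrow> real"
  assumes int: "integrable M X" "integrable M (\<lambda>\<omega>. (X \<omega>)\<^sup>2)"
    and mom: "expectation X = 0" "expectation (\<lambda>\<omega>. (X \<omega>)\<^sup>2) = 1"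
    and mid: "\<And>s t. prob {\<omega> \<in> space M. s \<le> X \<omega>} * prob {\<omega> \<in> space M. t \<le> X \<omega>}
      \<le> (prob {\<omega> \<in> space M. (s + t) / 2 \<le> X \<omega>})\<^sup>2"
  shows "prob {\<omega> \<in> space M. s \<le> X \<omega>} \<le> exp ((1 - s) / sqrt 3)"
proof (rule ccontr)
  have [measurable]: "X \<in> borel_measurable M" using int(1) by simp
  define H where "H x = prob {\<omega> \<in> space M. x \<le> X \<omega> + 1}" for x
  have H_eq: "H x = prob {\<omega> \<in> space M. x - 1 \<le> X \<omega>}" for x
    unfolding H_def by (intro arg_cong[where f=prob]) auto
  have H_mid: "H x * H y \<le> (H ((x + y) / 2))\<^sup>2" for x y
    using mid[of "x - 1" "y - 1"] by (simp add: H_eq field_simps)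
  have H_anti: "H y \<le> H x" if "x \<le> y" for x y
    unfolding H_def using that by (intro finite_measure_mono) auto
  have sq: "integrable M (\<lambda>\<omega>. (X \<omega> + c)\<^sup>2)" "expectation (\<lambda>\<omega>. (X \<omega> + c)\<^sup>2) = 1 + c\<^sup>2" for c
    using int mom by (auto simp: power2_sum prob_space)
  have H0: "1 / 2 \<le> H 0"
  proof -
    have "prob {\<omega> \<in> space M. 4 \<le> (X \<omega> + (-1))\<^sup>2} \<le> expectation (\<lambda>\<omega>. (X \<omega> + (-1))\<^sup>2) / 4"
      by (rule integral_Markov_inequality_measure[where A = "{}"]) (use sq(1)[of "-1"] in auto)
    then have *: "prob {\<omega> \<in> space M. 4 \<le> (X \<omega> - 1)\<^sup>2} \<le> 1 / 2" using sq(2)[of "-1"] by simp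
    have "4 \<le> (X \<omega> - 1)\<^sup>2" if "X \<omega> < - 1" for \<omega>
      using power_mono[of 2 "1 - X \<omega>" 2] that by (simp add: power2_commute)
    then have "{\<omega> \<in> space M. \<not> 0 \<le> X \<omega> + 1} \<subseteq> {\<omega> \<in> space M. 4 \<le> (X \<omega> - 1)\<^sup>2}" by auto
    then have "prob {\<omega> \<in> space M. \<not> 0 \<le> X \<omega> + 1} \<le> prob {\<omega> \<in> space M. 4 \<le> (X \<omega> - 1)\<^sup>2}"
      by (intro finite_measure_mono) auto
    moreover have "prob {\<omega> \<in> space M. \<not> 0 \<le> X \<omega> + 1} = 1 - H 0"
      unfolding H_def by (rule prob_neg) auto
    ultimately show ?thesis using * by simp
  qed
  assume "\<not> prob {\<omega> \<in> space M. s \<le> X \<omega>} \<le> exp ((1 - s) / sqrt 3)"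
  then have tail: "exp ((1 - s) / sqrt 3) < prob {\<omega> \<in> space M. s \<le> X \<omega>}" by simp
  have "exp ((1 - s) / sqrt 3) < 1" using tail prob_le_1 by (rule less_le_trans)
  then have s: "1 < s" by (simp add: divide_less_0_iff)
  \<comment> \<open>The rate is chosen so that \<open>exp (- r * S)\<close> is exactly the claimed bound at \<^term>\<open>s\<close>.\<close>
  define S r where "S = s + 1" and "r = (S - 2) / (sqrt 3 * S)"
  have S: "2 < S" using s by (simp add: S_def)
  have r: "0 < r" using S by (simp add: r_def)
  define y where "y = r * S"
  have y: "S = 2 + sqrt 3 * y" "0 < y" using S r by (auto simp: y_def r_def)
  have "exp (- r * S) = exp ((1 - s) / sqrt 3)" using S by (simp add: r_def S_def minus_divide_left)
  then have HS: "exp (- r * S) < H S" using tail by (simp add: H_eq S_def)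
  have decay: "exp (- r * x) / 2 \<le> H x" if x: "x \<in> {0..S}" for x
  proof -
    have "1 / 2 \<le> H x * exp (r * x)"
    proof (rule midpoint_log_concave_ge[where \<phi> = "\<lambda>x. H x * exp (r * x)" and \<delta> = "H S" and S = S])
      show "H x * exp (r * x) * (H y * exp (r * y)) \<le> (H ((x + y) / 2) * exp (r * ((x + y) / 2)))\<^sup>2" for x y
      proof -
        have "H x * exp (r * x) * (H y * exp (r * y)) = (H x * H y) * exp (r * (x + y))"
          by (simp add: exp_add distrib_left)
        also have "\<dots> \<le> (H ((x + y) / 2))\<^sup>2 * exp (r * (x + y))" by (intro mult_right_mono H_mid) auto
        also have "exp (r * (x + y)) = (exp (r * ((x + y) / 2)))\<^sup>2"
          by (simp add: power2_eq_square exp_add[symmetric] field_simps)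
        finally show ?thesis by (simp add: power_mult_distrib)
      qed
      show "0 < H S" using HS exp_gt_zero less_trans by blast
      show "H S \<le> H x * exp (r * x)" if "x \<in> {0..S}" for x
      proof -
        have "H S * 1 \<le> H x * exp (r * x)"
          using that r H_anti[of x S] by (intro mult_mono) (auto simp: H_def)
        then show ?thesis by simp
      qed
      have "exp (- r * S) * exp (r * S) \<le> H S * exp (r * S)" using HS by (intro mult_right_mono) auto
      then show "1 / 2 \<le> H S * exp (r * S)" by (simp add: exp_add[symmetric])
    qed (use H0 x in auto)
    then have "1 / 2 * exp (- r * x) \<le> H x * exp (r * x) * exp (- r * x)" by (intro mult_right_mono) auto
    then show ?thesis by (simp add: mult.assoc exp_add[symmetric])
  qed
  have "ennreal ((1 - (1 + r * S) * exp (- r * S)) / r\<^sup>2)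
      = (\<integral>\<^sup>+x. ennreal (x * exp (- r * x)) * indicator {0..S} x \<partial>lborel)"
    using r S by (intro nn_integral_linear_exponential[symmetric]) auto
  also have "\<dots> \<le> (\<integral>\<^sup>+x. ennreal (2 * x * H x) * indicator {0..S} x \<partial>lborel)"
  proof (intro nn_integral_mono)
    fix x
    show "ennreal (x * exp (- r * x)) * indicator {0..S} x \<le> ennreal (2 * x * H x) * indicator {0..S} x"
    proof (cases "x \<in> {0..S}")
      case True
      then have "x * exp (- r * x) \<le> 2 * x * H x"
        using mult_left_mono[OF decay[OF True], of "2 * x"] by simp
      then show ?thesis by (intro mult_right_mono ennreal_leI) auto
    qed simp
  qed
  also have "\<dots> \<le> ennreal (expectation (\<lambda>\<omega>. (X \<omega> + 1)\<^sup>2))"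
    unfolding H_def by (rule nn_integral_tail_le_second_moment) (use sq in auto)
  also have "\<dots> = ennreal 2" using sq(2)[of 1] by simp
  finally have "(1 - (1 + r * S) * exp (- r * S)) / r\<^sup>2 \<le> 2"
    by (simp only: ennreal_le_iff zero_le_numeral)
  then have "(1 - (1 + y) * exp (- y)) / r\<^sup>2 \<le> 2" by (simp add: y_def)
  then have upper: "1 - (1 + y) * exp (- y) \<le> 2 * r\<^sup>2" using r by (simp add: field_simps)
  \<comment> \<open>With \<open>S = 2 + sqrt 3 * y\<close> and \<open>r = y / S\<close> the quadratic Taylor bound for \<open>exp y\<close> reduces the
    contradiction to \<open>4 + 4 * sqrt 3 * y + 3 * y\<^sup>2 > 4 + 4 * y + 2 * y\<^sup>2\<close>.\<close>
  define D where "D = 2 + 2 * y + y\<^sup>2"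
  have D: "0 < D" using y by (simp add: D_def add_pos_nonneg)
  have "D / 2 \<le> exp y" using exp_lower_Taylor_quadratic[of y] y by (simp add: D_def add_divide_distrib)
  then have "(1 + y) / exp y \<le> (1 + y) / (D / 2)" using y D by (intro frac_le) auto
  also have "(1 + y) / (D / 2) = (D - y\<^sup>2) / D" by (simp add: D_def)
  also have "\<dots> = 1 - y\<^sup>2 / D" using D by (simp add: diff_divide_distrib)
  finally have "y\<^sup>2 / D \<le> 1 - (1 + y) * exp (- y)"
    unfolding exp_minus divide_inverse[symmetric] by simp
  then have "y\<^sup>2 / D \<le> 2 * r\<^sup>2" using upper by simp
  then have "y\<^sup>2 / D * S\<^sup>2 \<le> 2 * r\<^sup>2 * S\<^sup>2" by (rule mult_right_mono) simp
  also have "2 * r\<^sup>2 * S\<^sup>2 = 2 * y\<^sup>2" by (simp add: y_def power_mult_distrib)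
  finally have "y\<^sup>2 * S\<^sup>2 \<le> y\<^sup>2 * (2 * D)" using D by (simp add: divide_le_eq mult_ac)
  then have "S\<^sup>2 \<le> 2 * (2 + 2 * y + y\<^sup>2)" using y by (simp add: D_def)
  moreover have "S\<^sup>2 = 4 + 4 * sqrt 3 * y + 3 * y\<^sup>2"
    by (simp add: y(1) power2_sum power_mult_distrib)
  moreover have "1 * y \<le> sqrt 3 * y" using y by (intro mult_right_mono) auto
  moreover have "0 < y\<^sup>2" using y by simp
  ultimately show False by simp
qed

section \<open>The largest coordinate\<close>

lemma (in prob_space) isotropic_coordinate:
  fixes Z :: "'a \<Rightarrow> real ^ 'n"
  assumes "isotropic M Z"
  shows "integrable M (\<lambda>\<omega>. Z \<omega> $ i)" "integrable M (\<lambda>\<omega>. (Z \<omega> $ i)\<^sup>2)"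
    "expectation (\<lambda>\<omega>. Z \<omega> $ i) = 0" "expectation (\<lambda>\<omega>. (Z \<omega> $ i)\<^sup>2) = 1"
proof -
  have iso: "integrable M Z" "integrable M (\<lambda>\<omega>. (norm (Z \<omega>))\<^sup>2)" "integral\<^sup>L M Z = 0"
    "covariance_matrix M Z = mat 1"
    using assms by (auto simp: isotropic_def)
  show int: "integrable M (\<lambda>\<omega>. Z \<omega> $ i)"
    using iso(1) by (simp add: cart_eq_inner_axis)
  show "integrable M (\<lambda>\<omega>. (Z \<omega> $ i)\<^sup>2)"
  proof (rule Bochner_Integration.integrable_bound[OF iso(2)])
    show "(\<lambda>\<omega>. (Z \<omega> $ i)\<^sup>2) \<in> borel_measurable M"
      using borel_measurable_integrable[OF int] by measurable
    show "AE \<omega> in M. norm ((Z \<omega> $ i)\<^sup>2) \<le> norm ((norm (Z \<omega>))\<^sup>2)"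
    proof (rule AE_I2)
      fix \<omega>
      have "\<bar>Z \<omega> $ i\<bar>\<^sup>2 \<le> (norm (Z \<omega>))\<^sup>2" by (intro power_mono component_le_norm_cart) auto
      then show "norm ((Z \<omega> $ i)\<^sup>2) \<le> norm ((norm (Z \<omega>))\<^sup>2)" by simp
    qed
  qed
  show mean: "expectation (\<lambda>\<omega>. Z \<omega> $ i) = 0" using iso(1,3) by (simp add: cart_eq_inner_axis)
  have "covariance_matrix M Z $ i $ i = 1" by (simp add: iso(4) mat_def)
  then show "expectation (\<lambda>\<omega>. (Z \<omega> $ i)\<^sup>2) = 1"
    by (simp add: covariance_matrix_def mean power2_eq_square)
qed

lemma (in prob_space) isotropic_log_concave_coordinate_tail:
  fixes Z :: "'a \<Rightarrow> real ^ 'n"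
  assumes "log_concave M Z" and "isotropic M Z"
  shows "prob {\<omega> \<in> space M. s \<le> \<bar>Z \<omega> $ i\<bar>} \<le> 2 * exp ((1 - s) / sqrt 3)"
proof -
  note coord = isotropic_coordinate[OF assms(2), of i]
  have [measurable]: "(\<lambda>\<omega>. Z \<omega> $ i) \<in> borel_measurable M" using coord(1) by simp
  have up: "prob {\<omega> \<in> space M. s \<le> Z \<omega> $ i} \<le> exp ((1 - s) / sqrt 3)"
    using log_concave_half_space[OF assms(1), of _ "axis i 1"] coord
    by (intro log_concave_tail_bound) (auto simp: inner_axis)
  have down: "prob {\<omega> \<in> space M. s \<le> - Z \<omega> $ i} \<le> exp ((1 - s) / sqrt 3)"
    using log_concave_half_space[OF assms(1), of _ "- axis i 1"] coord
    by (intro log_concave_tail_bound) (auto simp: inner_axis)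
  have "prob {\<omega> \<in> space M. s \<le> \<bar>Z \<omega> $ i\<bar>}
      \<le> prob ({\<omega> \<in> space M. s \<le> Z \<omega> $ i} \<union> {\<omega> \<in> space M. s \<le> - Z \<omega> $ i})"
    by (intro finite_measure_mono) auto
  also have "\<dots> \<le> prob {\<omega> \<in> space M. s \<le> Z \<omega> $ i} + prob {\<omega> \<in> space M. s \<le> - Z \<omega> $ i}"
    by (intro measure_Un_le) auto
  finally show ?thesis using up down by simp
qed

text \<open>
  The rate \<open>1 / sqrt 3\<close> of the coordinate tails exceeds the rate \<open>(2 - \<epsilon>) / (2 sqrt 3)\<close> asked for, and the
  constant \<open>2 exp (1 / sqrt 3) \<le> 6\<close> is at most \<open>(8 - 2 \<epsilon>) / \<epsilon>\<close> because \<open>\<epsilon> \<le> 1\<close>.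
\<close>
theorem theorem2p38:
  fixes M :: "'a measure" and Z :: "'a \<Rightarrow> real ^ 'n" and \<epsilon> t :: real
  assumes "prob_space M"
    and "log_concave M Z"
    and "isotropic M Z"
    and "CARD('n) \<ge> 2"
    and "0 < \<epsilon>" and "\<epsilon> \<le> 1"
    and "t \<ge> 2 * sqrt 3 / (2 - \<epsilon>)"
  shows "measure M {\<omega> \<in> space M. (MAX i. \<bar>Z \<omega> $ i\<bar>) \<ge> t * ln (real CARD('n))}
           \<le> (8 - 2 * \<epsilon>) * inverse \<epsilon> / real CARD('n) powr ((2 - \<epsilon>) * t / (2 * sqrt 3) - 1)"
proof -
  interpret prob_space M by fact
  define n where "n = real CARD('n)"
  define L where "L = t * ln n"
  have n: "1 \<le> n" using assms(4) by (simp add: n_def)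
  have "0 \<le> 2 * sqrt 3 / (2 - \<epsilon>)" using assms(6) by simp
  then have t: "0 \<le> t" using assms(7) by simp
  have [measurable]: "(\<lambda>\<omega>. Z \<omega> $ i) \<in> borel_measurable M" for i
    using isotropic_coordinate(1)[OF assms(3)] by simp
  have "prob {\<omega> \<in> space M. L \<le> (MAX i. \<bar>Z \<omega> $ i\<bar>)}
      \<le> prob (\<Union>i. {\<omega> \<in> space M. L \<le> \<bar>Z \<omega> $ i\<bar>})"
    by (intro finite_measure_mono) (auto simp: Max_ge_iff)
  also have "\<dots> \<le> (\<Sum>i\<in>UNIV. prob {\<omega> \<in> space M. L \<le> \<bar>Z \<omega> $ i\<bar>})"
    by (intro finite_measure_subadditive_finite) auto
  also have "\<dots> \<le> (\<Sum>i\<in>(UNIV :: 'n set). 2 * exp ((1 - L) / sqrt 3))"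
    by (intro sum_mono isotropic_log_concave_coordinate_tail assms)
  also have "\<dots> = 2 * exp (1 / sqrt 3) * (n * exp (- (L / sqrt 3)))"
  proof -
    have "exp ((1 - L) / sqrt 3) = exp (1 / sqrt 3) * exp (- (L / sqrt 3))"
      by (simp add: exp_add[symmetric] diff_divide_distrib)
    then show ?thesis by (simp add: n_def)
  qed
  also have "n * exp (- (L / sqrt 3)) = n powr (1 - t / sqrt 3)"
    using n by (simp add: powr_def L_def left_diff_distrib exp_diff exp_minus divide_inverse)
  also have "2 * exp (1 / sqrt 3) * n powr (1 - t / sqrt 3)
      \<le> (8 - 2 * \<epsilon>) * inverse \<epsilon> * n powr (1 - (2 - \<epsilon>) * t / (2 * sqrt 3))"
  proof (rule mult_mono)
    have "exp (1 / sqrt 3) \<le> exp (1::real)" by simp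
    also have "\<dots> \<le> 3" by (rule exp_le)
    finally have "2 * exp (1 / sqrt 3) \<le> (6 :: real)" by simp
    also have "\<dots> \<le> (8 - 2 * \<epsilon>) * inverse \<epsilon>" using assms(5,6) by (simp add: field_simps)
    finally show "2 * exp (1 / sqrt 3) \<le> (8 - 2 * \<epsilon>) * inverse \<epsilon>" .
    have "(2 - \<epsilon>) * t / (2 * sqrt 3) \<le> 2 * t / (2 * sqrt 3)"
      using assms(5) t by (intro divide_right_mono mult_right_mono) auto
    then have "1 - t / sqrt 3 \<le> 1 - (2 - \<epsilon>) * t / (2 * sqrt 3)" by simp
    then show "n powr (1 - t / sqrt 3) \<le> n powr (1 - (2 - \<epsilon>) * t / (2 * sqrt 3))"
      using n by (rule powr_mono)
  qed (use n assms(5,6) in auto)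
  also have "\<dots> = (8 - 2 * \<epsilon>) * inverse \<epsilon> / n powr ((2 - \<epsilon>) * t / (2 * sqrt 3) - 1)"
  proof -
    have "n powr (1 - (2 - \<epsilon>) * t / (2 * sqrt 3)) = 1 / n powr ((2 - \<epsilon>) * t / (2 * sqrt 3) - 1)"
      using powr_minus_divide[of n "(2 - \<epsilon>) * t / (2 * sqrt 3) - 1"] by simp
    then show ?thesis by simp
  qed
  finally show ?thesis by (simp add: L_def n_def)
qed

end
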